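(* Let $R$ be a ring. Then the following are equivalent: (1) $R$ is Zhou nil-clean. (2) For any $a\in R$, there exist idempotents $e,f,g,h\in \mathbb{Z}[a]$ and a nilpotent $w\in R$ such that $a=e+f+g+h+w$. (3) For any $a\in R$, there exist idempotents $e,f,g,h\in R$ and a nilpotent $w\in R$ that (pairwise) commute such that $a=e+f+g+h+w$.
   Context: All rings are associative with an identity, not necessarily commutative. An element $t$ of a ring is tripotent if $t^3=t$. A ring $R$ is Zhou nil-clean if every element of $R$ is the sum of two tripotents and a nilpotent that (pairwise) commute. For $a\in R$, $\mathbb{Z}[a]=\{f(a) : f(t)\text{ is a polynomial with integral coefficients}\}\subseteq R$. *)

theory Defs
  imports "HOL-Algebra.Ring" "HOL-Computational_Algebra.Polynomial"
begin

text \<open>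
  The locale \<^locale>\<open>ring\<close> is associative and unital, not necessarily commutative, and
  does not exclude the zero ring.
\<close>

definition ring_idempotent :: "('a, 'm) ring_scheme \<Rightarrow> 'a \<Rightarrow> bool" where
  "ring_idempotent R e \<longleftrightarrow> e \<in> carrier R \<and> e \<otimes>\<^bsub>R\<^esub> e = e"

definition ring_tripotent :: "('a, 'm) ring_scheme \<Rightarrow> 'a \<Rightarrow> bool" where
  "ring_tripotent R t \<longleftrightarrow> t \<in> carrier R \<and> t [^]\<^bsub>R\<^esub> (3::nat) = t"

definition ring_nilpotent :: "('a, 'm) ring_scheme \<Rightarrow> 'a \<Rightarrow> bool" where
  "ring_nilpotent R w \<longleftrightarrow> w \<in> carrier R \<and> (\<exists>n::nat. n > 0 \<and> w [^]\<^bsub>R\<^esub> n = \<zero>\<^bsub>R\<^esub>)"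

text \<open>
  \<^const>\<open>pairwise\<close> only compares distinct elements; this loses nothing, since
  every element commutes with itself.
\<close>

definition pairwise_commute :: "('a, 'm) ring_scheme \<Rightarrow> 'a set \<Rightarrow> bool" where
  "pairwise_commute R S \<longleftrightarrow> pairwise (\<lambda>x y. x \<otimes>\<^bsub>R\<^esub> y = y \<otimes>\<^bsub>R\<^esub> x) S"

definition zhou_nil_clean :: "('a, 'm) ring_scheme \<Rightarrow> bool" where
  "zhou_nil_clean R \<longleftrightarrow>
     (\<forall>a \<in> carrier R. \<exists>p q w.
        ring_tripotent R p \<and> ring_tripotent R q \<and> ring_nilpotent R w \<and>
        pairwise_commute R {p, q, w} \<and> a = p \<oplus>\<^bsub>R\<^esub> q \<oplus>\<^bsub>R\<^esub> w)"

text \<open>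
  Evaluation of an integral polynomial at a ring element; the integer coefficients act by
  integer multiples \<open>[k] \<cdot>\<^bsub>R\<^esub> x\<close>.
\<close>

definition int_poly_eval :: "('a, 'm) ring_scheme \<Rightarrow> int poly \<Rightarrow> 'a \<Rightarrow> 'a" where
  "int_poly_eval R f a =
     (\<Oplus>\<^bsub>R\<^esub>i \<in> {..degree f}. [coeff f i] \<cdot>\<^bsub>R\<^esub> (a [^]\<^bsub>R\<^esub> i))"

text \<open>The subring \<open>\<int>[a]\<close> of \<open>R\<close>.\<close>

definition int_adjoin :: "('a, 'm) ring_scheme \<Rightarrow> 'a \<Rightarrow> 'a set" where
  "int_adjoin R a = {int_poly_eval R f a | f. True}"

end

theory Submission
  imports Defs
begin

text \<open>
  The implications run in a circle, and everything turns on the integral polynomial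
  \<open>D(t) = (t - 2)(t - 1)t(t + 1)(t + 2) = t\<^sup>5 - 5t\<^sup>3 + 4t\<close>.

  If \<open>R\<close> is Zhou nil-clean, then \<open>D(b)\<close> is nilpotent for every \<open>b \<in> R\<close>: a tripotent behaves like an
  element of \<open>{-1, 0, 1}\<close>, so a sum of two commuting tripotents is a root of \<open>D\<close>, and adding a
  commuting nilpotent changes the value of \<open>D\<close> by a nilpotent (\<open>zhou_nil_clean_quintic\<close>).

  Conversely, let \<open>N\<close> be the radical ideal of those \<open>f \<in> \<int>[x]\<close> for which \<open>f(a)\<close> is nilpotent, and
  suppose that \<open>D(f) \<in> N\<close> for all \<open>f\<close>. Then \<open>D(3) = 120 \<in> N\<close>, hence \<open>30 \<in> N\<close>, so that \<open>\<int>[x]/N\<close> splits into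
  parts of characteristic 2, 3 and 5. On these parts \<open>D(x) \<in> N\<close> says that
  \<open>x\<^sup>2 = x\<close>, \<open>x\<^sup>3 = x\<close> and \<open>x\<^sup>5 = x\<close>, respectively, so \<open>x\<close> is a function with values in
  \<open>{0, ..., p - 1}\<close> for \<open>p = 2, 3, 5\<close>. Such an \<open>x\<close> is the sum of the four indicator functions
  \<open>[x \<ge> 1], ..., [x \<ge> 4]\<close>, which are polynomials in \<open>x\<close> modulo \<open>N\<close>. Idempotents lift modulo nil ideals without
  leaving \<open>\<int>[a]\<close>, which gives (2) (\<open>four_idempotents\<close>).

  From (2) to (3), the nilpotent part is \<open>a\<close> minus elements of the commutative ring \<open>\<int>[a]\<close>, so it also lies
  in \<open>\<int>[a]\<close>. For (3) implies (1), decompose \<open>a + 2 = e + f + g + h + w\<close> and observe that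
  \<open>a = (e + f - 1) + (g + h - 1) + w\<close>, where \<open>e + f - 1\<close> and \<open>g + h - 1\<close> take values in
  \<open>{-1, 0, 1}\<close> and hence are tripotent (\<open>idempotent_sum_minus_one\<close>).

  All computations take place in commutative rings that map to \<open>R\<close>: in \<open>\<int>[x]\<close> for a single
  element, and in an iterated polynomial ring over \<open>\<int>\<close> for several commuting elements
  (\<open>commuting_triple\<close>).
\<close>

section \<open>Homomorphisms from commutative rings\<close>

text \<open>
  The source is a type of class \<^class>\<open>comm_ring_1\<close>, where polynomial identities are settled by
  simplification; applying \<open>\<phi>\<close> carries them to commuting elements of the noncommutative \<open>R\<close>.
\<close>

locale comm_ring_map = ring R
  for R :: "('a, 'm) ring_scheme" (structure) +
  fixes \<phi> :: "'c::comm_ring_1 \<Rightarrow> 'a"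
  assumes map_closed [simp]: "\<phi> r \<in> carrier R"
    and map_add: "\<phi> (r + s) = \<phi> r \<oplus> \<phi> s"
    and map_mult: "\<phi> (r * s) = \<phi> r \<otimes> \<phi> s"
    and map_one: "\<phi> 1 = \<one>"
begin

lemma map_zero: "\<phi> 0 = \<zero>"
  using map_add[of 0 0] by (metis add.l_cancel_one map_closed add_0)

lemma map_uminus: "\<phi> (- r) = \<ominus> \<phi> r"
  by (metis add.inv_equality map_closed add.left_inverse map_add map_zero)

lemma map_diff: "\<phi> (r - s) = \<phi> r \<ominus> \<phi> s"
  by (metis a_minus_def diff_conv_add_uminus map_add map_uminus)

lemma map_power: "\<phi> (r ^ n) = \<phi> r [^] n"
  by (induction n) (simp_all add: map_one map_mult power_Suc2 del: power_Suc)

lemmas map_simps = map_add map_mult map_one map_zero map_uminus map_diff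

lemma map_commute: "\<phi> r \<otimes> \<phi> s = \<phi> s \<otimes> \<phi> r"
  by (metis map_mult mult.commute)

text \<open>
  The preimage under \<open>\<phi>\<close> of the nilpotents of \<open>R\<close> is a radical ideal of the source, although the
  nilpotents of \<open>R\<close> need not form an ideal. The lemmas below are the closure rules of this ideal.
\<close>

definition nil_at :: "'c \<Rightarrow> bool" where
  "nil_at r \<longleftrightarrow> ring_nilpotent R (\<phi> r)"

lemma nil_at_iff: "nil_at r \<longleftrightarrow> (\<exists>n. \<phi> (r ^ n) = \<zero>)"
proof
  assume "\<exists>n. \<phi> (r ^ n) = \<zero>"
  then obtain n where "\<phi> (r ^ n) = \<zero>" by blast
  then have "\<phi> (r ^ Suc n) = \<zero>" by (simp add: map_mult)
  then show "nil_at r"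
    unfolding nil_at_def ring_nilpotent_def map_power using map_closed zero_less_Suc by blast
qed (auto simp: nil_at_def ring_nilpotent_def map_power)

lemma map_eq_zero_dvd: "\<phi> r = \<zero> \<Longrightarrow> r dvd s \<Longrightarrow> \<phi> s = \<zero>"
  by (auto simp: dvd_def map_mult)

lemma nil_at_kernel: "\<phi> r = \<zero> \<Longrightarrow> nil_at r"
  unfolding nil_at_iff by (metis power_one_right)

lemma nil_at_mult: "nil_at r \<Longrightarrow> nil_at (r * s)"
  unfolding nil_at_iff by (metis map_eq_zero_dvd dvd_triv_left power_mult_distrib)

lemma nil_at_mult_left: "nil_at r \<Longrightarrow> nil_at (s * r)"
  using nil_at_mult[of r s] by (simp add: mult.commute)

lemma nil_at_power: "nil_at (r ^ n) \<Longrightarrow> nil_at r"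
  unfolding nil_at_iff by (metis power_mult)

text \<open>
  Since \<open>(r + s)\<^sup>n \<equiv> r\<^sup>n\<close> modulo \<open>s\<close>, killing \<open>r\<^sup>n\<close> leaves \<open>(r + s)\<^sup>n\<close> equal to a multiple of \<open>s\<close>,
  whose \<open>m\<close>-th power vanishes with \<open>s\<^sup>m\<close>.
\<close>

lemma nil_at_add:
  assumes "nil_at r" "nil_at s"
  shows "nil_at (r + s)"
proof -
  obtain n m where n: "\<phi> (r ^ n) = \<zero>" and m: "\<phi> (s ^ m) = \<zero>"
    using assms unfolding nil_at_iff by blast
  have "s dvd (r + s) ^ n - r ^ n"
  proof (induction n)
    case (Suc n)
    have "(r + s) ^ Suc n - r ^ Suc n = r * ((r + s) ^ n - r ^ n) + s * (r + s) ^ n"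
      by (simp add: algebra_simps)
    then show ?case using Suc by simp
  qed simp
  then obtain k where "(r + s) ^ n = r ^ n + s * k"
    by (metis add_diff_cancel_left' diff_add_cancel add.commute dvdE)
  then have "\<phi> ((r + s) ^ n) = \<phi> (s * k)"
    by (simp add: map_add n)
  then have "\<phi> (((r + s) ^ n) ^ m) = \<phi> ((s * k) ^ m)"
    by (simp add: map_power)
  also have "\<dots> = \<zero>"
    by (rule map_eq_zero_dvd[OF m]) (simp add: power_mult_distrib)
  finally show ?thesis
    unfolding nil_at_iff by (metis power_mult)
qed

lemma nil_at_uminus: "nil_at r \<Longrightarrow> nil_at (- r)"
  using nil_at_mult[of r "-1"] by simp

end

section \<open>Lifting idempotents\<close>

text \<open>
  Newton iteration for the equation \<open>g\<^sup>2 = g\<close>: the substitution \<open>g \<mapsto> 3g\<^sup>2 - 2g\<^sup>3\<close> fixes 0 and 1 to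
  second order, so it squares the defect \<open>g\<^sup>2 - g\<close> up to a factor. Counting the exponent from
  \<open>Suc n\<close> makes squaring strictly increase it at every step.
\<close>

lemma idempotent_lift_step:
  fixes f :: "'c::comm_ring_1"
  shows "\<exists>g. (f^2 - f) ^ Suc n dvd g^2 - g \<and> f^2 - f dvd g - f"
proof (induction n)
  case 0
  show ?case by (rule exI[of _ f]) simp
next
  case (Suc n)
  then obtain g where g: "(f^2 - f) ^ Suc n dvd g^2 - g" "f^2 - f dvd g - f" by blast
  define h where "h = 3 * g^2 - 2 * g^3"
  have u: "f^2 - f dvd g^2 - g"
    using g(1) by (meson dvd_power dvd_trans zero_less_Suc)
  have "h^2 - h = (g^2 - g) * (g^2 - g) * (4 * (g^2 - g) - 3)"
    unfolding h_def by (simp add: power_numeral_reduce algebra_simps)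
  moreover have "(f^2 - f) * (f^2 - f) ^ Suc n dvd (g^2 - g) * (g^2 - g)"
    using u g(1) by (rule mult_dvd_mono)
  ultimately have "(f^2 - f) ^ Suc (Suc n) dvd h^2 - h" by simp
  moreover have "h - f = (g - f) + (g^2 - g) * (1 - 2 * g)"
    unfolding h_def by (simp add: power_numeral_reduce algebra_simps)
  then have "f^2 - f dvd h - f" using g(2) u by (metis dvd_add dvd_mult2)
  ultimately show ?case by blast
qed

context comm_ring_map
begin

lemma idempotent_lift:
  assumes "nil_at (f^2 - f)"
  obtains g where "ring_idempotent R (\<phi> g)" "nil_at (f - g)"
proof -
  obtain n where n: "\<phi> ((f^2 - f) ^ n) = \<zero>"
    using assms unfolding nil_at_iff by blast
  obtain g where g: "(f^2 - f) ^ Suc n dvd g^2 - g" "f^2 - f dvd g - f"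
    using idempotent_lift_step by blast
  have "\<phi> (g^2 - g) = \<zero>"
    using map_eq_zero_dvd[OF n] g(1) by (meson dvd_trans le_imp_power_dvd lessI less_imp_le)
  then have "\<phi> g \<otimes> \<phi> g = \<phi> g"
    by (metis add_diff_cancel_left' diff_add_cancel map_add map_closed map_mult power2_eq_square l_zero)
  then have "ring_idempotent R (\<phi> g)" by (simp add: ring_idempotent_def)
  moreover obtain k where "g - f = (f^2 - f) * k" using g(2) by blast
  then have "nil_at (f - g)"
    using nil_at_uminus[OF nil_at_mult[OF assms]] by (metis minus_diff_eq)
  ultimately show thesis by (rule that)
qed

section \<open>Evaluation of polynomials at commuting elements\<close>

text \<open>Horner evaluation, because the recursion over \<^const>\<open>pCons\<close> is what all inductions use.\<close>

definition poly_extend :: "'a \<Rightarrow> 'c poly \<Rightarrow> 'a" where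
  "poly_extend x f = fold_coeffs (\<lambda>c r. \<phi> c \<oplus> x \<otimes> r) f \<zero>"

lemma poly_extend_0 [simp]: "poly_extend x 0 = \<zero>"
  by (simp add: poly_extend_def)

lemma poly_extend_pCons:
  "x \<in> carrier R \<Longrightarrow> poly_extend x (pCons c f) = \<phi> c \<oplus> x \<otimes> poly_extend x f"
  by (cases "c = 0 \<and> f = 0") (auto simp: poly_extend_def map_zero)

lemma poly_extend_closed [simp]: "x \<in> carrier R \<Longrightarrow> poly_extend x f \<in> carrier R"
  by (induction f) (simp_all add: poly_extend_pCons)

lemma poly_extend_const [simp]: "x \<in> carrier R \<Longrightarrow> poly_extend x [:c:] = \<phi> c"
  by (simp add: poly_extend_pCons)

lemma poly_extend_var [simp]: "x \<in> carrier R \<Longrightarrow> poly_extend x [:0, 1:] = x"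
  by (simp add: poly_extend_pCons map_zero map_one)

text \<open>
  An element that commutes with all coefficients and with \<open>x\<close> commutes with every value, so it can
  be adjoined in turn.
\<close>

lemma poly_extend_commute:
  assumes "x \<in> carrier R" "y \<in> carrier R"
    and "\<And>r. \<phi> r \<otimes> y = y \<otimes> \<phi> r" and "x \<otimes> y = y \<otimes> x"
  shows "poly_extend x f \<otimes> y = y \<otimes> poly_extend x f"
proof (induction f)
  case (pCons c f)
  have "x \<otimes> poly_extend x f \<otimes> y = y \<otimes> (x \<otimes> poly_extend x f)"
    using assms pCons by (metis m_assoc poly_extend_closed)
  then show ?case
    using assms by (simp add: poly_extend_pCons l_distr r_distr)
qed (use assms in simp)

lemma comm_ring_map_poly_extend:
  assumes x: "x \<in> carrier R" and comm: "\<And>r. \<phi> r \<otimes> x = x \<otimes> \<phi> r"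
  shows "comm_ring_map R (poly_extend x)"
proof
  have add: "poly_extend x (f + g) = poly_extend x f \<oplus> poly_extend x g" for f g
  proof (induction f g rule: poly_induct2)
    case (pCons a f b g)
    then show ?case
      using x by (simp add: poly_extend_pCons map_add r_distr a_ac)
  qed simp
  have smult: "poly_extend x (smult c g) = \<phi> c \<otimes> poly_extend x g" for c g
  proof (induction g)
    case (pCons a g)
    have "x \<otimes> (\<phi> c \<otimes> poly_extend x g) = \<phi> c \<otimes> (x \<otimes> poly_extend x g)"
      using x comm by (metis m_assoc poly_extend_closed map_closed)
    with pCons show ?case
      using x by (simp add: poly_extend_pCons map_mult r_distr m_assoc)
  qed simp
  have mult: "poly_extend x (f * g) = poly_extend x f \<otimes> poly_extend x g" for f g
  proof (induction f)
    case (pCons a f)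
    then show ?case
      using x by (simp add: add smult poly_extend_pCons map_zero l_distr m_assoc)
  qed (use x in simp)
  show "poly_extend x f \<in> carrier R" for f using x by simp
  show "poly_extend x (f + g) = poly_extend x f \<oplus> poly_extend x g" for f g by (rule add)
  show "poly_extend x (f * g) = poly_extend x f \<otimes> poly_extend x g" for f g by (rule mult)
  show "poly_extend x 1 = \<one>" using x by (simp add: one_pCons map_one)
qed

lemma poly_extend_finsum:
  assumes "x \<in> carrier R" and comm: "\<And>r. \<phi> r \<otimes> x = x \<otimes> \<phi> r"
  shows "poly_extend x f = (\<Oplus>i\<in>{..degree f}. \<phi> (coeff f i) \<otimes> x [^] i)"
proof (induction f)
  case 0
  show ?case by (simp add: map_zero)
next
  case (pCons c f)
  show ?case
  proof (cases "f = 0")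
    case True
    then show ?thesis using assms(1) by (simp add: poly_extend_pCons)
  next
    case False
    have "x \<otimes> poly_extend x f = (\<Oplus>i\<in>{..degree f}. x \<otimes> (\<phi> (coeff f i) \<otimes> x [^] i))"
      unfolding pCons using assms(1) by (intro finsum_rdistr) auto
    also have "\<dots> = (\<Oplus>i\<in>{..degree f}. \<phi> (coeff f i) \<otimes> x [^] Suc i)"
    proof (rule finsum_cong')
      fix i
      show "x \<otimes> (\<phi> (coeff f i) \<otimes> x [^] i) = \<phi> (coeff f i) \<otimes> x [^] Suc i"
        using assms by (metis m_assoc map_closed nat_pow_closed nat_pow_Suc2)
    qed (use assms(1) in auto)
    finally show ?thesis
      using False assms(1)
      by (simp add: poly_extend_pCons finsum_Suc2 a_comm del: nat_pow_Suc finsum_Suc)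
  qed
qed

text \<open>
  One step of building a map that hits several commuting elements. The last clause hands the
  commutation hypothesis on to the next step, and using an abstract \<open>\<psi>\<close> and \<open>X\<close> avoids nested
  evaluation terms.
\<close>

lemma adjoin_commuting:
  assumes "x \<in> carrier R" "\<And>r. \<phi> r \<otimes> x = x \<otimes> \<phi> r"
  obtains \<psi> :: "'c poly \<Rightarrow> 'a" and X where "comm_ring_map R \<psi>" "\<psi> X = x" "\<And>r. \<psi> [:r:] = \<phi> r"
    "\<And>y f. \<lbrakk>y \<in> carrier R; \<And>r. \<phi> r \<otimes> y = y \<otimes> \<phi> r; x \<otimes> y = y \<otimes> x\<rbrakk> \<Longrightarrow> \<psi> f \<otimes> y = y \<otimes> \<psi> f"
  using assms comm_ring_map_poly_extend poly_extend_const poly_extend_commute poly_extend_var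
  by (metis (no_types, lifting))

end

context ring
begin

lemma comm_ring_map_int: "comm_ring_map R (\<lambda>k::int. [k] \<cdot> \<one>)"
proof
  fix k l :: int
  show "[(k + l)] \<cdot> \<one> = [k] \<cdot> \<one> \<oplus> [l] \<cdot> \<one>"
    by (simp add: add.int_pow_mult)
  have "[(k * l)] \<cdot> \<one> = [k] \<cdot> ([l] \<cdot> \<one>)"
    by (metis add.int_pow_pow one_closed mult.commute)
  also have "\<dots> = [k] \<cdot> \<one> \<otimes> [l] \<cdot> \<one>"
    by (simp add: add_pow_ldistr_int)
  finally show "[(k * l)] \<cdot> \<one> = [k] \<cdot> \<one> \<otimes> [l] \<cdot> \<one>" .
qed simp_all

lemma int_multiple_commute: "x \<in> carrier R \<Longrightarrow> [(k::int)] \<cdot> \<one> \<otimes> x = x \<otimes> [k] \<cdot> \<one>"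
  by (simp add: add_pow_ldistr_int add_pow_rdistr_int)

lemma int_poly_eval_eq:
  assumes "a \<in> carrier R"
  shows "int_poly_eval R f a = comm_ring_map.poly_extend R (\<lambda>k::int. [k] \<cdot> \<one>) a f"
  unfolding int_poly_eval_def comm_ring_map.poly_extend_finsum[OF comm_ring_map_int assms int_multiple_commute[OF assms]]
  using assms by (intro finsum_cong') (auto simp: add_pow_ldistr_int)

lemma int_poly_eval_map:
  assumes "a \<in> carrier R"
  shows "comm_ring_map R (\<lambda>f. int_poly_eval R f a)" and "int_poly_eval R [:0, 1:] a = a"
  using assms comm_ring_map.comm_ring_map_poly_extend[OF comm_ring_map_int assms int_multiple_commute[OF assms]]
  by (simp_all add: int_poly_eval_eq comm_ring_map.poly_extend_var[OF comm_ring_map_int])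


text \<open>
  Commuting elements \<open>x\<close>, \<open>y\<close>, \<open>z\<close> of \<open>R\<close> are the images of the variables of
  \<open>\<int>[X][Y][Z]\<close>; therefore any identity for them may be checked in a commutative ring.
\<close>

lemma commuting_triple:
  assumes carrier: "x \<in> carrier R" "y \<in> carrier R" "z \<in> carrier R"
    and comm: "x \<otimes> y = y \<otimes> x" "x \<otimes> z = z \<otimes> x" "y \<otimes> z = z \<otimes> y"
  obtains \<psi> :: "int poly poly poly \<Rightarrow> 'a" and X Y Z
  where "comm_ring_map R \<psi>" "\<psi> X = x" "\<psi> Y = y" "\<psi> Z = z"
proof -
  interpret C: comm_ring_map R "\<lambda>k::int. [k] \<cdot> \<one>" by (rule comm_ring_map_int)
  obtain \<psi>1 :: "int poly \<Rightarrow> 'a" and X1 where 1: "comm_ring_map R \<psi>1" "\<psi>1 X1 = x"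
    "\<And>c f. \<lbrakk>c \<in> carrier R; \<And>k::int. [k] \<cdot> \<one> \<otimes> c = c \<otimes> [k] \<cdot> \<one>; x \<otimes> c = c \<otimes> x\<rbrakk> \<Longrightarrow> \<psi>1 f \<otimes> c = c \<otimes> \<psi>1 f"
    using C.adjoin_commuting[OF carrier(1)] int_multiple_commute[OF carrier(1)] by metis
  interpret A: comm_ring_map R \<psi>1 by (rule 1(1))
  have 1: "\<psi>1 f \<otimes> y = y \<otimes> \<psi>1 f" "\<psi>1 f \<otimes> z = z \<otimes> \<psi>1 f" "\<psi>1 X1 = x" for f
    using 1 comm carrier int_multiple_commute by auto
  obtain \<psi>2 :: "int poly poly \<Rightarrow> 'a" and Y2 where 2: "comm_ring_map R \<psi>2" "\<psi>2 Y2 = y" "\<And>r. \<psi>2 [:r:] = \<psi>1 r"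
    "\<And>c f. \<lbrakk>c \<in> carrier R; \<And>r. \<psi>1 r \<otimes> c = c \<otimes> \<psi>1 r; y \<otimes> c = c \<otimes> y\<rbrakk> \<Longrightarrow> \<psi>2 f \<otimes> c = c \<otimes> \<psi>2 f"
    using A.adjoin_commuting[OF carrier(2) 1(1)] by metis
  interpret B: comm_ring_map R \<psi>2 by (rule 2(1))
  have comm2: "\<psi>2 f \<otimes> z = z \<otimes> \<psi>2 f" for f
    using 2(4) 1 comm carrier by auto
  obtain \<psi>3 :: "int poly poly poly \<Rightarrow> 'a" and Z3 where 3: "comm_ring_map R \<psi>3" "\<psi>3 Z3 = z" "\<And>r. \<psi>3 [:r:] = \<psi>2 r"
    using B.adjoin_commuting[OF carrier(3) comm2] by metis
  show thesis
    by (rule that[of \<psi>3 "[:[:X1:]:]" "[:Y2:]" Z3]) (simp_all add: 3 2 1)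
qed

end

section \<open>The quintic satisfied modulo nilpotents\<close>

lemma pairwise_commuteD:
  "\<lbrakk>pairwise_commute R S; x \<in> S; y \<in> S\<rbrakk> \<Longrightarrow> x \<otimes>\<^bsub>R\<^esub> y = y \<otimes>\<^bsub>R\<^esub> x"
  unfolding pairwise_commute_def pairwise_def by metis

text \<open>
  The polynomial \<open>D\<close> with roots \<open>-2, ..., 2\<close>. The factored form without numerals is preserved
  literally by ring homomorphisms.
\<close>

definition quintic :: "'c::comm_ring_1 \<Rightarrow> 'c" where
  "quintic t = (t - 1 - 1) * (t - 1) * t * (t + 1) * (t + 1 + 1)"

lemma quintic_expand: "quintic t = t^5 - 5 * t^3 + 4 * t"
  unfolding quintic_def by (simp add: power_numeral_reduce algebra_simps)

text \<open>
  An explicit membership in the ideal generated by \<open>p\<^sup>3 - p\<close>, \<open>q\<^sup>3 - q\<close> and \<open>w\<close>. The first two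
  cofactors come from reducing \<open>D(p + q)\<close> with \<open>p\<^sup>3 = p\<close> and \<open>q\<^sup>3 = q\<close>, the third is the difference
  quotient \<open>(D(p + q + w) - D(p + q)) / w\<close>.
\<close>

lemma quintic_sum:
  fixes p q w :: "'c::comm_ring_1"
  shows "quintic (p + q + w) =
    (p^3 - p) * (p^2 + 5 * p * q + 10 * q^2 - 4) + (q^3 - q) * (q^2 + 5 * p * q + 10 * p^2 - 4)
    + w * (5 * (p + q)^4 + 10 * (p + q)^3 * w + 10 * (p + q)^2 * w^2 + 5 * (p + q) * w^3 + w^4
           - 5 * (3 * (p + q)^2 + 3 * (p + q) * w + w^2) + 4)"
  unfolding quintic_expand by (simp add: power_numeral_reduce algebra_simps)

context comm_ring_map
begin

lemma zhou_nil_clean_quintic: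
  assumes "zhou_nil_clean R"
  shows "nil_at (quintic t)"
proof -
  obtain p q w where pqw: "ring_tripotent R p" "ring_tripotent R q" "ring_nilpotent R w"
    "pairwise_commute R {p, q, w}" and t: "\<phi> t = p \<oplus> q \<oplus> w"
    using assms unfolding zhou_nil_clean_def by (meson map_closed)
  \<comment> \<open>The tripotents and the nilpotent need not lie in the image of \<open>\<phi>\<close>, so the computation moves to
    a second map \<open>\<psi>\<close>; the two maps agree on the value of the quintic.\<close>
  have "p \<in> carrier R" "q \<in> carrier R" "w \<in> carrier R"
    using pqw by (auto simp: ring_tripotent_def ring_nilpotent_def)
  then obtain \<psi> :: "int poly poly poly \<Rightarrow> 'a" and P Q W
    where \<psi>: "comm_ring_map R \<psi>" "\<psi> P = p" "\<psi> Q = q" "\<psi> W = w"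
    using commuting_triple[of p q w] pairwise_commuteD[OF pqw(4)] by (metis insertCI)
  interpret S: comm_ring_map R \<psi> by (rule \<psi>(1))
  have "S.nil_at (P^3 - P)" "S.nil_at (Q^3 - Q)"
    using pqw \<psi> by (auto intro!: S.nil_at_kernel simp: S.map_diff S.map_power ring_tripotent_def a_minus_def r_neg)
  moreover have "S.nil_at W" using pqw \<psi> by (simp add: S.nil_at_def)
  ultimately have "S.nil_at (quintic (P + Q + W))"
    unfolding quintic_sum by (intro S.nil_at_add S.nil_at_mult)
  moreover have "\<phi> t = \<psi> (P + Q + W)" using t \<psi> by (simp add: S.map_add)
  then have "\<phi> (quintic t) = \<psi> (quintic (P + Q + W))"
    unfolding quintic_def by (simp only: map_simps S.map_mult S.map_diff S.map_one S.map_add[of _ 1])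
  ultimately show ?thesis by (simp add: nil_at_def S.nil_at_def)
qed

section \<open>Four idempotents in the subring generated by an element\<close>

text \<open>
  The integers 15, 10 and 6 are idempotent modulo 30 and project onto the parts of characteristic 2,
  3 and 5. Hence elements that are idempotent on the respective parts glue to one that is
  idempotent on the whole.
\<close>

lemma nil_at_idempotent_combination:
  assumes "nil_at 30" "nil_at (15 * (\<alpha>^2 - \<alpha>))" "nil_at (10 * (\<beta>^2 - \<beta>))" "nil_at (6 * (\<gamma>^2 - \<gamma>))"
    and "e = 15 * \<alpha> + 10 * \<beta> + 6 * \<gamma>"
  shows "nil_at (e^2 - e)"
proof -
  have "e^2 - e = 15 * (\<alpha>^2 - \<alpha>) + 10 * (\<beta>^2 - \<beta>) + 6 * (\<gamma>^2 - \<gamma>)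
      + 30 * (7 * \<alpha>^2 + 3 * \<beta>^2 + \<gamma>^2 + 10 * \<alpha> * \<beta> + 6 * \<alpha> * \<gamma> + 4 * \<beta> * \<gamma>)"
    unfolding assms(5) by (simp add: power2_eq_square algebra_simps)
  with assms(1-4) show ?thesis
    by (simp only: nil_at_add nil_at_mult)
qed

text \<open>
  The indicator \<open>[x \<ge> i]\<close> on the part of characteristic \<open>p\<close>, for \<open>i = 1, 2, 3, 4\<close>, obtained by Lagrange
  interpolation modulo \<open>p\<close>, is

  \<^item> \<open>x, 0, 0, 0\<close> for \<open>p = 2\<close>,
  \<^item> \<open>x\<^sup>2, x - x\<^sup>2, 0, 0\<close> for \<open>p = 3\<close>,
  \<^item> \<open>x\<^sup>4\<close> and the polynomials \<open>\<gamma>2, \<gamma>3, \<gamma>4\<close> of the proof for \<open>p = 5\<close>.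

  Modulo 30 the glued idempotents sum to \<open>15x + 10x + 6x = 31x = x\<close>.
\<close>

lemma four_idempotents:
  assumes quintic: "\<And>t. nil_at (quintic t)"
  obtains e f g h where "ring_idempotent R (\<phi> e)" "ring_idempotent R (\<phi> f)"
    "ring_idempotent R (\<phi> g)" "ring_idempotent R (\<phi> h)" "nil_at (x - (e + f + g + h))"
proof -
  have "nil_at (120 * 225)"
    using nil_at_mult[OF quintic[of 3], of 225] by (simp add: quintic_def)
  \<comment> \<open>\<open>30\<^sup>3 = 120 \<cdot> 225\<close>.\<close>
  then have nil30: "nil_at 30"
    using nil_at_power[of 30 3] by simp
  \<comment> \<open>Modulo 2 the quintic is \<open>x\<^sup>3(x - 1)\<^sup>2\<close>, which divides the cube of \<open>x\<^sup>2 - x\<close>.\<close>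
  have mod2: "nil_at (15 * (x^2 - x))"
  proof -
    have "(15 * (x^2 - x)) ^ 3 = (15 * quintic x + 30 * (3 * x^3 - x^4 - 2 * x)) * (225 * (x - 1))"
      unfolding quintic_expand by (simp add: power_numeral_reduce algebra_simps)
    then have "nil_at ((15 * (x^2 - x)) ^ 3)"
      by (simp only: quintic nil30 nil_at_add nil_at_mult nil_at_mult_left)
    then show ?thesis by (rule nil_at_power)
  qed
  \<comment> \<open>Modulo 3 the quintic is \<open>x(x\<^sup>2 - 1)\<^sup>2\<close>, which divides the square of \<open>x\<^sup>3 - x\<close>.\<close>
  have mod3: "nil_at (10 * (x^3 - x))"
  proof -
    have "(10 * (x^3 - x)) ^ 2 = (10 * quintic x + 30 * (x^3 - x)) * (10 * x)"
      unfolding quintic_expand by (simp add: power_numeral_reduce algebra_simps)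
    then have "nil_at ((10 * (x^3 - x)) ^ 2)"
      by (simp only: quintic nil30 nil_at_add nil_at_mult nil_at_mult_left)
    then show ?thesis by (rule nil_at_power)
  qed
  have mod5: "nil_at (6 * (x^5 - x))"
  proof -
    have "6 * (x^5 - x) = 6 * quintic x + 30 * (x^3 - x)"
      unfolding quintic_expand by (simp add: algebra_simps)
    then show ?thesis
      by (simp only: quintic nil30 nil_at_add nil_at_mult nil_at_mult_left)
  qed
  have nil0: "nil_at 0" by (simp add: nil_at_kernel map_zero)

  define \<beta>2 where "\<beta>2 = x - x^2"
  define \<gamma>2 where "\<gamma>2 = 2 * x^4 + x^3 + x^2 + x"
  define \<gamma>3 where "\<gamma>3 = 3 * x^3 - 2 * x^4 - x"
  define \<gamma>4 where "\<gamma>4 = x^3 - x^4 - x^2 + x"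
  \<comment> \<open>The cofactors below are quotient and remainder of \<open>y\<^sup>2 - y\<close> on division by \<open>x\<^sup>p - x\<close>; the remainder
    is divisible by \<open>p\<close>.\<close>
  have "10 * ((x^2)^2 - x^2) = 10 * (x^3 - x) * x"
    by (simp add: power_numeral_reduce algebra_simps)
  then have \<beta>1: "nil_at (10 * ((x^2)^2 - x^2))"
    by (simp only: nil_at_mult[OF mod3])
  have "10 * (\<beta>2^2 - \<beta>2) = 10 * (x^3 - x) * (x - 2) + 30 * (x^2 - x)"
    unfolding \<beta>2_def by (simp add: power_numeral_reduce algebra_simps)
  then have \<beta>2: "nil_at (10 * (\<beta>2^2 - \<beta>2))"
    by (simp only: nil_at_add[OF nil_at_mult[OF mod3] nil_at_mult[OF nil30]])
  have "6 * ((x^4)^2 - x^4) = 6 * (x^5 - x) * x^3"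
    by (simp add: power_numeral_reduce algebra_simps)
  then have \<gamma>1: "nil_at (6 * ((x^4)^2 - x^4))"
    by (simp only: nil_at_mult[OF mod5])
  have "6 * (\<gamma>2^2 - \<gamma>2) = 6 * (x^5 - x) * (4 * x^3 + 4 * x^2 + 5 * x + 6) + 30 * (x^4 + x^3 + x^2 + x)"
    unfolding \<gamma>2_def by (simp add: power_numeral_reduce algebra_simps)
  then have \<gamma>2: "nil_at (6 * (\<gamma>2^2 - \<gamma>2))"
    by (simp only: nil_at_add[OF nil_at_mult[OF mod5] nil_at_mult[OF nil30]])
  have "6 * (\<gamma>3^2 - \<gamma>3) = 6 * (x^5 - x) * (4 * x^3 - 12 * x^2 + 9 * x + 4) + 30 * (x + 2 * x^2 - 3 * x^3)"
    unfolding \<gamma>3_def by (simp add: power_numeral_reduce algebra_simps)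
  then have \<gamma>3: "nil_at (6 * (\<gamma>3^2 - \<gamma>3))"
    by (simp only: nil_at_add[OF nil_at_mult[OF mod5] nil_at_mult[OF nil30]])
  have "6 * (\<gamma>4^2 - \<gamma>4) = 6 * (x^5 - x) * (x^3 - 2 * x^2 + 3 * x - 4) + 30 * (x^4 - x^3 + x^2 - x)"
    unfolding \<gamma>4_def by (simp add: power_numeral_reduce algebra_simps)
  then have \<gamma>4: "nil_at (6 * (\<gamma>4^2 - \<gamma>4))"
    by (simp only: nil_at_add[OF nil_at_mult[OF mod5] nil_at_mult[OF nil30]])

  \<comment> \<open>The zero summands keep the shape in which the gluing lemma applies.\<close>
  define e1 where "e1 = 15 * x + 10 * x^2 + 6 * x^4"
  define e2 where "e2 = 15 * 0 + 10 * \<beta>2 + 6 * \<gamma>2"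
  define e3 where "e3 = 15 * 0 + 10 * 0 + 6 * \<gamma>3"
  define e4 where "e4 = 15 * 0 + 10 * 0 + 6 * \<gamma>4"
  have "nil_at (e1^2 - e1)"
    using nil_at_idempotent_combination[OF nil30 mod2 \<beta>1 \<gamma>1 e1_def] .
  then obtain e where e: "ring_idempotent R (\<phi> e)" "nil_at (e1 - e)"
    using idempotent_lift by blast
  have "nil_at (e2^2 - e2)"
    using nil_at_idempotent_combination[OF nil30 _ \<beta>2 \<gamma>2 e2_def] nil0 by simp
  then obtain f where f: "ring_idempotent R (\<phi> f)" "nil_at (e2 - f)"
    using idempotent_lift by blast
  have "nil_at (e3^2 - e3)"
    using nil_at_idempotent_combination[OF nil30 _ _ \<gamma>3 e3_def] nil0 by simp
  then obtain g where g: "ring_idempotent R (\<phi> g)" "nil_at (e3 - g)"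
    using idempotent_lift by blast
  have "nil_at (e4^2 - e4)"
    using nil_at_idempotent_combination[OF nil30 _ _ \<gamma>4 e4_def] nil0 by simp
  then obtain h where h: "ring_idempotent R (\<phi> h)" "nil_at (e4 - h)"
    using idempotent_lift by blast
  have "x - (e + f + g + h) = 30 * (- x - x^3) + (e1 - e) + (e2 - f) + (e3 - g) + (e4 - h)"
    unfolding e1_def e2_def e3_def e4_def \<beta>2_def \<gamma>2_def \<gamma>3_def \<gamma>4_def
    by (simp add: algebra_simps)
  then have "nil_at (x - (e + f + g + h))"
    by (simp only: e f g h nil30 nil_at_add nil_at_mult)
  with e f g h show thesis by (intro that)
qed

end

section \<open>The implications between the three conditions\<close>

context ring
begin

text \<open>
  As \<open>e\<close> and \<open>f\<close> take values in \<open>{0, 1}\<close>, the element \<open>e + f - 1\<close> takes values in \<open>{-1, 0, 1}\<close>. The second claim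
  is stated with a spectator \<open>x\<close> so that the lemma can be applied to \<open>g\<close>, \<open>h\<close> with
  \<open>x = e + f - 1\<close> in turn.
\<close>

lemma idempotent_sum_minus_one:
  assumes "ring_idempotent R e" "ring_idempotent R f" "x \<in> carrier R"
    and "e \<otimes> f = f \<otimes> e" "e \<otimes> x = x \<otimes> e" "f \<otimes> x = x \<otimes> f"
  shows "ring_tripotent R (e \<oplus> f \<ominus> \<one>)" and "(e \<oplus> f \<ominus> \<one>) \<otimes> x = x \<otimes> (e \<oplus> f \<ominus> \<one>)"
proof -
  have carrier: "e \<in> carrier R" "f \<in> carrier R"
    using assms by (auto simp: ring_idempotent_def)
  obtain \<psi> :: "int poly poly poly \<Rightarrow> 'a" and E F X
    where \<psi>: "comm_ring_map R \<psi>" "\<psi> E = e" "\<psi> F = f" "\<psi> X = x"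
    using commuting_triple[OF carrier assms(3-6)] .
  interpret S: comm_ring_map R \<psi> by (rule \<psi>(1))
  define T where "T = E + F - 1"
  have T: "\<psi> T = e \<oplus> f \<ominus> \<one>" by (simp add: T_def S.map_simps \<psi>)
  have "\<psi> (E^2 - E) = \<zero>" "\<psi> (F^2 - F) = \<zero>"
    using assms \<psi> by (auto simp: S.map_simps power2_eq_square ring_idempotent_def a_minus_def r_neg)
  \<comment> \<open>With \<open>u = e + f\<close> one has \<open>T\<^sup>3 - T = u(u - 1)(u - 2)\<close>, reduced here by \<open>e\<^sup>2 = e\<close> and \<open>f\<^sup>2 = f\<close>.\<close>
  moreover have "T^3 = T + ((E^2 - E) * (E + 3 * F - 2) + (F^2 - F) * (F + 3 * E - 2))"
    unfolding T_def by (simp add: power_numeral_reduce algebra_simps)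
  ultimately have "\<psi> (T^3) = \<psi> T"
    by (simp add: S.map_add S.map_mult)
  then show "ring_tripotent R (e \<oplus> f \<ominus> \<one>)"
    unfolding T[symmetric] by (simp add: ring_tripotent_def S.map_power)
  show "(e \<oplus> f \<ominus> \<one>) \<otimes> x = x \<otimes> (e \<oplus> f \<ominus> \<one>)"
    using S.map_commute[of T X] by (simp add: T \<psi>)
qed

lemma zhou_nil_clean_four_idempotents:
  assumes "zhou_nil_clean R" and a: "a \<in> carrier R"
  shows "\<exists>e f g h w.
           e \<in> int_adjoin R a \<and> f \<in> int_adjoin R a \<and> g \<in> int_adjoin R a \<and> h \<in> int_adjoin R a \<and>
           ring_idempotent R e \<and> ring_idempotent R f \<and> ring_idempotent R g \<and>
           ring_idempotent R h \<and> ring_nilpotent R w \<and> a = e \<oplus> f \<oplus> g \<oplus> h \<oplus> w"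
proof -
  interpret E: comm_ring_map R "\<lambda>f. int_poly_eval R f a"
    by (rule int_poly_eval_map[OF a])
  let ?ev = "\<lambda>f. int_poly_eval R f a"
  obtain e f g h where efgh: "ring_idempotent R (?ev e)" "ring_idempotent R (?ev f)"
    "ring_idempotent R (?ev g)" "ring_idempotent R (?ev h)"
    "E.nil_at ([:0, 1:] - (e + f + g + h))"
    using E.four_idempotents[OF E.zhou_nil_clean_quintic[OF assms(1)]] by blast
  let ?w = "[:0, 1:] - (e + f + g + h)"
  have "?ev e \<oplus> ?ev f \<oplus> ?ev g \<oplus> ?ev h \<oplus> ?ev ?w = ?ev (e + f + g + h + ?w)"
    by (simp only: E.map_add)
  also have "\<dots> = a" by (simp add: int_poly_eval_map(2)[OF a])
  finally have "a = ?ev e \<oplus> ?ev f \<oplus> ?ev g \<oplus> ?ev h \<oplus> ?ev ?w" ..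
  moreover have "?ev r \<in> int_adjoin R a" for r
    unfolding int_adjoin_def by blast
  moreover have "ring_nilpotent R (?ev ?w)"
    using efgh(5) by (simp only: E.nil_at_def)
  ultimately show ?thesis
    using efgh(1-4) by blast
qed

text \<open>
  Subtracting the four other summands from \<open>a\<close> shows that \<open>w\<close> lies in \<open>\<int>[a]\<close> as well.
\<close>

lemma int_adjoin_decomposition_commutes:
  assumes a: "a \<in> carrier R"
    and "e \<in> int_adjoin R a" "f \<in> int_adjoin R a" "g \<in> int_adjoin R a" "h \<in> int_adjoin R a"
    and w: "w \<in> carrier R" and sum: "a = e \<oplus> f \<oplus> g \<oplus> h \<oplus> w"
  shows "pairwise_commute R {e, f, g, h, w}"
proof -
  interpret E: comm_ring_map R "\<lambda>f. int_poly_eval R f a"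
    by (rule int_poly_eval_map[OF a])
  obtain E F G H where ev: "e = int_poly_eval R E a" "f = int_poly_eval R F a"
    "g = int_poly_eval R G a" "h = int_poly_eval R H a"
    using assms(2-5) unfolding int_adjoin_def by blast
  define s where "s = int_poly_eval R (E + F + G + H) a"
  have "a = s \<oplus> w" unfolding s_def E.map_add using sum ev by simp
  then have "w = a \<ominus> s"
    using w E.map_closed[of "E + F + G + H", folded s_def]
    by (simp add: a_minus_def a_comm[of s w] a_assoc r_neg)
  also have "\<dots> = int_poly_eval R ([:0, 1:] - (E + F + G + H)) a"
    by (simp only: s_def E.map_diff int_poly_eval_map(2)[OF a])
  finally have "{e, f, g, h, w} = (\<lambda>f. int_poly_eval R f a) ` {E, F, G, H, [:0, 1:] - (E + F + G + H)}"
    by (simp only: ev image_insert image_empty)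
  then show ?thesis
    by (simp only: pairwise_commute_def pairwise_image) (simp only: pairwise_def E.map_commute simp_thms ball_triv)
qed

text \<open>
  The decomposition is applied to \<open>a + 2\<close>, so that the two units taken off the pairs of idempotents
  cancel the shift.
\<close>

lemma four_idempotents_imp_zhou_nil_clean:
  assumes decomp: "\<forall>a \<in> carrier R. \<exists>e f g h w.
           ring_idempotent R e \<and> ring_idempotent R f \<and> ring_idempotent R g \<and>
           ring_idempotent R h \<and> ring_nilpotent R w \<and>
           pairwise_commute R {e, f, g, h, w} \<and> a = e \<oplus> f \<oplus> g \<oplus> h \<oplus> w"
  shows "zhou_nil_clean R"
  unfolding zhou_nil_clean_def
proof
  fix a assume a: "a \<in> carrier R"
  then obtain e f g h w where idem: "ring_idempotent R e" "ring_idempotent R f"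
      "ring_idempotent R g" "ring_idempotent R h" and w: "ring_nilpotent R w"
    and comm: "pairwise_commute R {e, f, g, h, w}"
    and sum: "a \<oplus> (\<one> \<oplus> \<one>) = e \<oplus> f \<oplus> g \<oplus> h \<oplus> w"
    using decomp by (metis add.m_closed one_closed)
  have carrier: "e \<in> carrier R" "f \<in> carrier R" "g \<in> carrier R" "h \<in> carrier R" "w \<in> carrier R"
    using idem w by (auto simp: ring_idempotent_def ring_nilpotent_def)
  define p q where "p = e \<oplus> f \<ominus> \<one>" and "q = g \<oplus> h \<ominus> \<one>"
  have c: "e \<otimes> f = f \<otimes> e" "g \<otimes> h = h \<otimes> g" "e \<otimes> g = g \<otimes> e" "f \<otimes> g = g \<otimes> f" "e \<otimes> h = h \<otimes> e"
    "f \<otimes> h = h \<otimes> f" "e \<otimes> w = w \<otimes> e" "f \<otimes> w = w \<otimes> f" "g \<otimes> w = w \<otimes> g" "h \<otimes> w = w \<otimes> h"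
    by (rule pairwise_commuteD[OF comm]; blast)+
  note p_rules = idempotent_sum_minus_one[OF idem(1,2) _ c(1), folded p_def]
  note q_rules = idempotent_sum_minus_one[OF idem(3,4) _ c(2), folded q_def]
  have p: "ring_tripotent R p" "p \<otimes> g = g \<otimes> p" "p \<otimes> h = h \<otimes> p" "p \<otimes> w = w \<otimes> p"
    using p_rules[OF carrier(3) c(3,4)] p_rules[OF carrier(4) c(5,6)] p_rules[OF carrier(5) c(7,8)]
    by blast+
  have "p \<in> carrier R" using p(1) by (simp add: ring_tripotent_def)
  then have q: "ring_tripotent R q" "q \<otimes> p = p \<otimes> q" "q \<otimes> w = w \<otimes> q"
    using q_rules[OF _ p(2,3)[symmetric]] q_rules[OF carrier(5) c(9,10)]
    by blast+
  have "p \<oplus> q \<oplus> w = (e \<oplus> f \<oplus> g \<oplus> h \<oplus> w) \<ominus> (\<one> \<oplus> \<one>)"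
    unfolding p_def q_def using carrier by (simp add: a_minus_def a_ac minus_add)
  also have "\<dots> = a"
    unfolding sum[symmetric] using a by (simp add: a_minus_def a_assoc r_neg)
  finally have "a = p \<oplus> q \<oplus> w" ..
  moreover have "pairwise_commute R {p, q, w}"
    using p(4) q(2,3) by (auto simp: pairwise_commute_def pairwise_insert)
  ultimately show "\<exists>p q w. ring_tripotent R p \<and> ring_tripotent R q \<and> ring_nilpotent R w \<and>
      pairwise_commute R {p, q, w} \<and> a = p \<oplus> q \<oplus> w"
    using p(1) q(1) w by blast
qed

end

theorem theorem2p5:
  fixes R :: "('a, 'm) ring_scheme"
  assumes "ring R"
  shows
    "(zhou_nil_clean R \<longleftrightarrow>
        (\<forall>a \<in> carrier R. \<exists>e f g h w.
           e \<in> int_adjoin R a \<and> f \<in> int_adjoin R a \<and> g \<in> int_adjoin R a \<and> h \<in> int_adjoin R a \<and>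
           ring_idempotent R e \<and> ring_idempotent R f \<and> ring_idempotent R g \<and>
           ring_idempotent R h \<and> ring_nilpotent R w \<and>
           a = e \<oplus>\<^bsub>R\<^esub> f \<oplus>\<^bsub>R\<^esub> g \<oplus>\<^bsub>R\<^esub> h \<oplus>\<^bsub>R\<^esub> w))
     \<and>
     (zhou_nil_clean R \<longleftrightarrow>
        (\<forall>a \<in> carrier R. \<exists>e f g h w.
           ring_idempotent R e \<and> ring_idempotent R f \<and> ring_idempotent R g \<and>
           ring_idempotent R h \<and> ring_nilpotent R w \<and>
           pairwise_commute R {e, f, g, h, w} \<and>
           a = e \<oplus>\<^bsub>R\<^esub> f \<oplus>\<^bsub>R\<^esub> g \<oplus>\<^bsub>R\<^esub> h \<oplus>\<^bsub>R\<^esub> w))"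
proof -
  interpret ring R by (rule assms)
  let ?two = "\<forall>a \<in> carrier R. \<exists>e f g h w.
           e \<in> int_adjoin R a \<and> f \<in> int_adjoin R a \<and> g \<in> int_adjoin R a \<and> h \<in> int_adjoin R a \<and>
           ring_idempotent R e \<and> ring_idempotent R f \<and> ring_idempotent R g \<and>
           ring_idempotent R h \<and> ring_nilpotent R w \<and>
           a = e \<oplus>\<^bsub>R\<^esub> f \<oplus>\<^bsub>R\<^esub> g \<oplus>\<^bsub>R\<^esub> h \<oplus>\<^bsub>R\<^esub> w"
  let ?three = "\<forall>a \<in> carrier R. \<exists>e f g h w.
           ring_idempotent R e \<and> ring_idempotent R f \<and> ring_idempotent R g \<and>
           ring_idempotent R h \<and> ring_nilpotent R w \<and>
           pairwise_commute R {e, f, g, h, w} \<and>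
           a = e \<oplus>\<^bsub>R\<^esub> f \<oplus>\<^bsub>R\<^esub> g \<oplus>\<^bsub>R\<^esub> h \<oplus>\<^bsub>R\<^esub> w"
  have one_two: "?two" if "zhou_nil_clean R"
    using zhou_nil_clean_four_idempotents[OF that] by (rule ballI)
  have two_three: "?three" if two: "?two"
  proof
    fix a assume a: "a \<in> carrier R"
    obtain e f g h w where *:
      "e \<in> int_adjoin R a" "f \<in> int_adjoin R a" "g \<in> int_adjoin R a" "h \<in> int_adjoin R a"
      "ring_idempotent R e" "ring_idempotent R f" "ring_idempotent R g" "ring_idempotent R h"
      "ring_nilpotent R w" "a = e \<oplus>\<^bsub>R\<^esub> f \<oplus>\<^bsub>R\<^esub> g \<oplus>\<^bsub>R\<^esub> h \<oplus>\<^bsub>R\<^esub> w"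
      using bspec[OF two a] by blast
    then have "pairwise_commute R {e, f, g, h, w}"
      using a by (intro int_adjoin_decomposition_commutes) (simp_all add: ring_nilpotent_def)
    with * show "\<exists>e f g h w.
           ring_idempotent R e \<and> ring_idempotent R f \<and> ring_idempotent R g \<and>
           ring_idempotent R h \<and> ring_nilpotent R w \<and>
           pairwise_commute R {e, f, g, h, w} \<and>
           a = e \<oplus>\<^bsub>R\<^esub> f \<oplus>\<^bsub>R\<^esub> g \<oplus>\<^bsub>R\<^esub> h \<oplus>\<^bsub>R\<^esub> w"
      by blast
  qed
  have three_one: "zhou_nil_clean R" if "?three"
    using that by (rule four_idempotents_imp_zhou_nil_clean)
  show ?thesis
  proof (intro conjI iffI)
    assume one: "zhou_nil_clean R"
    show "?two" using one by (rule one_two)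
    show "?three" using one_two[OF one] by (rule two_three)
  next
    assume "?two"
    then show "zhou_nil_clean R" using two_three three_one by blast
  qed (rule three_one)
qed

end
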